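(* Let an LCTRS with rules $\mathcal{R}$ be constructor-sound. Let $\mathcal{R}'=\{f(\ell_1,\dots,\ell_n)\to r\,[\varphi]\in\mathcal{R}\mid \text{every }\ell_i\text{ is a constructor term of }\mathcal{R}\}$. Then the LCTRS with rules $\mathcal{R}$ is quasi-reductive if and only if both of the following hold: (i) the same LCTRS with rules $\mathcal{R}'$ instead of $\mathcal{R}$ is quasi-reductive; (ii) every constructor symbol with respect to $\mathcal{R}'$ is also a constructor with respect to $\mathcal{R}$.
   Context: An LCTRS is given by a many-sorted signature $\Sigma=\Sigma_{terms}\cup\Sigma_{theory}$, interpretations of the theory part, and a set $\mathcal{R}$ of constrained rules $\ell\to r\,[\varphi]$. Values are certain constants of $\Sigma_{theory}$; $\Sigma_{terms}\cap\Sigma_{theory}$ contains only values. Calculation symbols are the non-value symbols of $\Sigma_{theory}$, each with a calculation rule $f(x_1,\dots,x_n)\to y\,[y=f(x_1,\dots,x_n)]$; $s\to_{\mathcal{R}}t$ is a rewrite step with a rule of $\mathcal{R}$ or a calculation rule, under a substitution instantiating the constraint's variables and fresh right-hand-side variables by values making the constraint true. With respect to a rule set $\mathcal{R}$: defined symbols are the root symbols of left-hand sides of rules in $\mathcal{R}$; constructors are the remaining symbols of $\Sigma_{terms}$ together with all values; constructor terms are terms built from constructors and variables; ground constructor terms are variable-free constructor terms. The LCTRS with rules $\mathcal{R}$ is quasi-reductive if every ground term is either a ground constructor term (w.r.t. $\mathcal{R}$) or reduces by $\to_{\mathcal{R}}$. It is constructor-sound if for every sort $\iota$ that occurs as an argument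 sort of some defined symbol there is a ground constructor term of sort $\iota$. *)

theory Defs
  imports Main
begin

datatype ('f, 'v) trm = Var 'v | Fun 'f "('f, 'v) trm list"

primrec vars :: "('f, 'v) trm \<Rightarrow> 'v set" where
  "vars (Var x) = {x}"
| "vars (Fun f ts) = \<Union> (set (map vars ts))"

primrec syms :: "('f, 'v) trm \<Rightarrow> 'f set" where
  "syms (Var x) = {}"
| "syms (Fun f ts) = insert f (\<Union> (set (map syms ts)))"

primrec subst :: "('v \<Rightarrow> ('f, 'v) trm) \<Rightarrow> ('f, 'v) trm \<Rightarrow> ('f, 'v) trm" where
  "subst \<gamma> (Var x) = \<gamma> x"
| "subst \<gamma> (Fun f ts) = Fun f (map (subst \<gamma>) ts)"

text \<open>A constrained rule \<open>l \<rightarrow> r [\<phi>]\<close> is the triple \<open>(l, r, \<phi>)\<close>.\<close>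

type_synonym ('f, 'v) rule = "('f, 'v) trm \<times> ('f, 'v) trm \<times> ('f, 'v) trm"

text \<open>
  Everything an LCTRS consists of apart from its rules. The sorts are all elements of \<open>'s\<close>, the
  variables all elements of \<open>'v\<close>; the declaration of \<open>f\<close> is \<open>arg_sorts f \<Rightarrow> res_sort f\<close>. The
  carriers of all sorts live in one type \<open>'d\<close>, in which \<open>truth True\<close> and \<open>truth False\<close> are the
  two booleans. The symbol \<open>eq_sym \<iota>\<close> is the equality on \<open>\<iota>\<close> used in calculation rules. Values
  of sort \<open>\<iota>\<close> are those members of \<open>vals\<close> whose result sort is \<open>\<iota>\<close>.
\<close>

record ('f, 's, 'v, 'd) lc_sig =
  term_syms :: "'f set"
  theory_syms :: "'f set"
  arg_sorts :: "'f \<Rightarrow> 's list"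
  res_sort :: "'f \<Rightarrow> 's"
  var_sort :: "'v \<Rightarrow> 's"
  carrier_of :: "'s \<Rightarrow> 'd set"
  interp :: "'f \<Rightarrow> 'd list \<Rightarrow> 'd"
  vals :: "'f set"
  bool_sort :: 's
  truth :: "bool \<Rightarrow> 'd"
  eq_sym :: "'s \<Rightarrow> 'f"

definition all_syms :: "('f, 's, 'v, 'd) lc_sig \<Rightarrow> 'f set" where
  "all_syms S = term_syms S \<union> theory_syms S"

definition theory_sorts :: "('f, 's, 'v, 'd) lc_sig \<Rightarrow> 's set" where
  "theory_sorts S = (\<Union>f\<in>theory_syms S. insert (res_sort S f) (set (arg_sorts S f)))"

definition calc_syms :: "('f, 's, 'v, 'd) lc_sig \<Rightarrow> 'f set" where
  "calc_syms S = theory_syms S - vals S"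

text \<open>\<open>has_sort S F t \<iota>\<close>: \<open>t\<close> is a well-sorted term of sort \<open>\<iota>\<close> over the symbols in \<open>F\<close>.\<close>

inductive has_sort :: "('f, 's, 'v, 'd) lc_sig \<Rightarrow> 'f set \<Rightarrow> ('f, 'v) trm \<Rightarrow> 's \<Rightarrow> bool"
  for S :: "('f, 's, 'v, 'd) lc_sig" and F :: "'f set" where
  has_sort_Var: "has_sort S F (Var x) (var_sort S x)"
| has_sort_Fun: "f \<in> F \<Longrightarrow> list_all2 (has_sort S F) ts (arg_sorts S f)
    \<Longrightarrow> has_sort S F (Fun f ts) (res_sort S f)"

definition is_term :: "('f, 's, 'v, 'd) lc_sig \<Rightarrow> ('f, 'v) trm \<Rightarrow> bool" where
  "is_term S t \<longleftrightarrow> (\<exists>\<iota>. has_sort S (all_syms S) t \<iota>)"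

text \<open>
  The condition on \<open>var_sort\<close> makes fresh variables available at every sort, as the calculation
  rules require. The last condition makes the constraints of the calculation rules expressible.
\<close>

definition wf_sig :: "('f, 's, 'v, 'd) lc_sig \<Rightarrow> bool" where
  "wf_sig S \<longleftrightarrow>
     (\<forall>\<iota>. infinite {x. var_sort S x = \<iota>}) \<and>
     term_syms S \<inter> theory_syms S \<subseteq> vals S \<and>
     (\<forall>f\<in>theory_syms S. \<forall>as. list_all2 (\<lambda>a \<iota>. a \<in> carrier_of S \<iota>) as (arg_sorts S f)
        \<longrightarrow> interp S f as \<in> carrier_of S (res_sort S f)) \<and>
     vals S \<subseteq> theory_syms S \<and>
     (\<forall>c\<in>vals S. arg_sorts S c = []) \<and>
     (\<forall>\<iota>\<in>theory_sorts S.
        bij_betw (\<lambda>c. interp S c []) {c \<in> vals S. res_sort S c = \<iota>} (carrier_of S \<iota>)) \<and>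
     bool_sort S \<in> theory_sorts S \<and>
     bij_betw (truth S) UNIV (carrier_of S (bool_sort S)) \<and>
     (\<forall>\<kappa>\<in>res_sort S ` calc_syms S.
        eq_sym S \<kappa> \<in> theory_syms S \<and>
        arg_sorts S (eq_sym S \<kappa>) = [\<kappa>, \<kappa>] \<and>
        res_sort S (eq_sym S \<kappa>) = bool_sort S \<and>
        (\<forall>a\<in>carrier_of S \<kappa>. \<forall>b\<in>carrier_of S \<kappa>.
           interp S (eq_sym S \<kappa>) [a, b] = truth S (a = b)))"

text \<open>
  A constraint is a term of sort bool over the theory symbols. A left-hand side is not a variable
  and contains a symbol that is not a theory symbol; its root may well be a calculation symbol.
\<close>

definition wf_rule :: "('f, 's, 'v, 'd) lc_sig \<Rightarrow> ('f, 'v) rule \<Rightarrow> bool" where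
  "wf_rule S = (\<lambda>(l, r, \<phi>).
     (\<exists>\<iota>. has_sort S (all_syms S) l \<iota> \<and> has_sort S (all_syms S) r \<iota>) \<and>
     has_sort S (theory_syms S) \<phi> (bool_sort S) \<and>
     (\<exists>f ls. l = Fun f ls) \<and>
     syms l \<inter> (term_syms S - theory_syms S) \<noteq> {})"

definition lctrs :: "('f, 's, 'v, 'd) lc_sig \<Rightarrow> ('f, 'v) rule set \<Rightarrow> bool" where
  "lctrs S R \<longleftrightarrow> wf_sig S \<and> (\<forall>\<rho>\<in>R. wf_rule S \<rho>)"

text \<open>Only meaningful on ground terms over the theory symbols.\<close>

primrec eval_ground :: "('f, 's, 'v, 'd) lc_sig \<Rightarrow> ('f, 'v) trm \<Rightarrow> 'd" where
  "eval_ground S (Var x) = undefined"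
| "eval_ground S (Fun f ts) = interp S f (map (eval_ground S) ts)"

definition is_subst :: "('f, 's, 'v, 'd) lc_sig \<Rightarrow> ('v \<Rightarrow> ('f, 'v) trm) \<Rightarrow> bool" where
  "is_subst S \<gamma> \<longleftrightarrow> (\<forall>x. has_sort S (all_syms S) (\<gamma> x) (var_sort S x))"

definition respects_rule ::
  "('f, 's, 'v, 'd) lc_sig \<Rightarrow> ('v \<Rightarrow> ('f, 'v) trm) \<Rightarrow> ('f, 'v) rule \<Rightarrow> bool" where
  "respects_rule S \<gamma> = (\<lambda>(l, r, \<phi>).
     (\<forall>x \<in> vars \<phi> \<union> (vars r - vars l). \<exists>c\<in>vals S. \<gamma> x = Fun c []) \<and>
     eval_ground S (subst \<gamma> \<phi>) = truth S True)"

text \<open>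
  The rules \<open>f(x\<^sub>1,\<dots>,x\<^sub>n) \<rightarrow> y [y = f(x\<^sub>1,\<dots>,x\<^sub>n)]\<close>, for all choices of distinct variables of the
  right sorts; the choice does not affect the rewrite relation.
\<close>

definition calc_rules :: "('f, 's, 'v, 'd) lc_sig \<Rightarrow> ('f, 'v) rule set" where
  "calc_rules S =
     {(Fun f (map Var xs), Var y, Fun (eq_sym S (res_sort S f)) [Var y, Fun f (map Var xs)]) | f xs y.
        f \<in> calc_syms S \<and> distinct (y # xs) \<and>
        map (var_sort S) xs = arg_sorts S f \<and> var_sort S y = res_sort S f}"

inductive rewrite_step ::
  "('f, 's, 'v, 'd) lc_sig \<Rightarrow> ('f, 'v) rule set \<Rightarrow> ('f, 'v) trm \<Rightarrow> ('f, 'v) trm \<Rightarrow> bool"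
  for S :: "('f, 's, 'v, 'd) lc_sig" and R :: "('f, 'v) rule set" where
  rewrite_step_root: "(l, r, \<phi>) \<in> R \<union> calc_rules S \<Longrightarrow> is_subst S \<gamma> \<Longrightarrow> respects_rule S \<gamma> (l, r, \<phi>)
    \<Longrightarrow> rewrite_step S R (subst \<gamma> l) (subst \<gamma> r)"
| rewrite_step_arg: "rewrite_step S R s t \<Longrightarrow> is_term S (Fun f (us @ s # ws))
    \<Longrightarrow> rewrite_step S R (Fun f (us @ s # ws)) (Fun f (us @ t # ws))"

definition defined_syms :: "('f, 'v) rule set \<Rightarrow> 'f set" where
  "defined_syms R = {f. \<exists>ls r \<phi>. (Fun f ls, r, \<phi>) \<in> R}"

definition constructors :: "('f, 's, 'v, 'd) lc_sig \<Rightarrow> ('f, 'v) rule set \<Rightarrow> 'f set" where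
  "constructors S R = (term_syms S - defined_syms R) \<union> vals S"

definition constructor_term ::
  "('f, 's, 'v, 'd) lc_sig \<Rightarrow> ('f, 'v) rule set \<Rightarrow> ('f, 'v) trm \<Rightarrow> bool" where
  "constructor_term S R t \<longleftrightarrow> (\<exists>\<iota>. has_sort S (constructors S R) t \<iota>)"

definition quasi_reductive :: "('f, 's, 'v, 'd) lc_sig \<Rightarrow> ('f, 'v) rule set \<Rightarrow> bool" where
  "quasi_reductive S R \<longleftrightarrow>
     (\<forall>t. is_term S t \<and> vars t = {} \<longrightarrow> constructor_term S R t \<or> (\<exists>u. rewrite_step S R t u))"

definition constructor_sound :: "('f, 's, 'v, 'd) lc_sig \<Rightarrow> ('f, 'v) rule set \<Rightarrow> bool" where
  "constructor_sound S R \<longleftrightarrow>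
     (\<forall>f\<in>defined_syms R. \<forall>\<iota>\<in>set (arg_sorts S f).
        \<exists>t. vars t = {} \<and> has_sort S (constructors S R) t \<iota>)"

definition constructor_rules ::
  "('f, 's, 'v, 'd) lc_sig \<Rightarrow> ('f, 'v) rule set \<Rightarrow> ('f, 'v) rule set" where
  "constructor_rules S R =
     {(Fun f ls, r, \<phi>) | f ls r \<phi>. (Fun f ls, r, \<phi>) \<in> R \<and> (\<forall>l\<in>set ls. constructor_term S R l)}"

end

theory Submission
  imports Defs
begin

text \<open>
  Ground constructor terms are irreducible, so a step from \<open>f(t\<^sub>1,\<dots>,t\<^sub>n)\<close> with constructor terms
  \<open>t\<^sub>i\<close> takes place at the root. If it uses \<open>f(l\<^sub>1,\<dots>,l\<^sub>n) \<rightarrow> r [\<phi>]\<close> from \<open>R\<close>, then each \<open>l\<^sub>i\<close> has a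
  constructor instance and is therefore itself a constructor term, so the rule belongs to \<open>R'\<close>.
  Constructor-soundness provides such arguments \<open>t\<^sub>i\<close> for every defined symbol, which gives (ii);
  (i) then follows by induction on ground terms.
\<close>

lemma has_sort_imp_syms_subset: "has_sort S F t \<iota> \<Longrightarrow> syms t \<subseteq> F"
proof (induction rule: has_sort.induct)
  case (has_sort_Fun f ts)
  then show ?case
    by (fastforce simp: list_all2_conv_all_nth in_set_conv_nth)
qed simp

lemma has_sort_change_syms: "has_sort S F t \<iota> \<Longrightarrow> syms t \<subseteq> G \<Longrightarrow> has_sort S G t \<iota>"
proof (induction rule: has_sort.induct)
  case (has_sort_Fun f ts)
  have "list_all2 (has_sort S G) ts (arg_sorts S f)"
    using has_sort_Fun.IH has_sort_Fun.prems
    by (fastforce simp: list_all2_conv_all_nth in_set_conv_nth)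
  with has_sort_Fun.prems show ?case
    by (intro has_sort.has_sort_Fun) auto
qed (rule has_sort.has_sort_Var)

lemma has_sort_FunE:
  assumes "has_sort S F (Fun f ts) \<iota>"
  obtains "f \<in> F" "\<iota> = res_sort S f" "list_all2 (has_sort S F) ts (arg_sorts S f)"
  using assms by (cases rule: has_sort.cases) auto

lemma is_term_arg: "is_term S (Fun f ts) \<Longrightarrow> t \<in> set ts \<Longrightarrow> is_term S t"
  unfolding is_term_def
  by (fastforce elim!: has_sort_FunE simp: list_all2_conv_all_nth in_set_conv_nth)

text \<open>Whether a term has a sort does not depend on the rules, so being a constructor term
  reduces to an inclusion of symbol sets. Passing between \<open>R\<close> and \<open>R'\<close>
  then only means comparing \<open>constructors\<close>.\<close>

lemma constructor_term_iff:
  "constructor_term S R t \<longleftrightarrow> (\<exists>\<iota> F. has_sort S F t \<iota>) \<and> syms t \<subseteq> constructors S R"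
  unfolding constructor_term_def
  by (meson has_sort_change_syms has_sort_imp_syms_subset)

lemma syms_subset_syms_subst: "syms t \<subseteq> syms (subst \<gamma> t)"
  by (induction t) auto

lemma constructors_antimono: "R' \<subseteq> R \<Longrightarrow> constructors S R \<subseteq> constructors S R'"
  by (auto simp: constructors_def defined_syms_def)

lemma constructor_rules_subset: "constructor_rules S R \<subseteq> R"
  by (auto simp: constructor_rules_def)

lemma rewrite_step_mono: "rewrite_step S R s t \<Longrightarrow> R \<subseteq> Q \<Longrightarrow> rewrite_step S Q s t"
  by (induction rule: rewrite_step.induct) (auto intro: rewrite_step.intros)

text \<open>A value has no arguments, so as a root it would leave no room for the non-theory symbol
  that a left-hand side must contain. A calculation symbol is a non-value theory symbol, hence
  outside \<open>term_syms S\<close> too.\<close>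

lemma rule_root:
  assumes "lctrs S R" "(l, r, \<phi>) \<in> R \<union> calc_rules S"
  obtains f ls where "l = Fun f ls" "f \<notin> constructors S R"
proof (cases "(l, r, \<phi>) \<in> R")
  case True
  then have wf: "wf_rule S (l, r, \<phi>)" using assms(1) by (auto simp: lctrs_def)
  then obtain f ls where l: "l = Fun f ls" by (auto simp: wf_rule_def)
  have "f \<notin> vals S"
  proof
    assume f: "f \<in> vals S"
    then have "arg_sorts S f = []" "f \<in> theory_syms S"
      using assms(1) by (auto simp: lctrs_def wf_sig_def)
    moreover from wf l have "list_all2 (has_sort S (all_syms S)) ls (arg_sorts S f)"
      by (auto simp: wf_rule_def elim: has_sort_FunE)
    ultimately have "syms l \<subseteq> theory_syms S" using l by simp
    with wf show False by (auto simp: wf_rule_def)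
  qed
  moreover have "f \<in> defined_syms R" using True l by (auto simp: defined_syms_def)
  ultimately show ?thesis using that l by (auto simp: constructors_def)
next
  case False
  then obtain f xs where "l = Fun f (map Var xs)" "f \<in> calc_syms S"
    using assms(2) by (auto simp: calc_rules_def)
  then show ?thesis
    using that assms(1) by (auto simp: constructors_def calc_syms_def lctrs_def wf_sig_def)
qed

text \<open>Substitution preserves the non-constructor root of a left-hand side, and a surrounding
  context keeps it as a symbol of the term.\<close>

lemma rewrite_step_not_constructor:
  assumes "lctrs S R"
  shows "rewrite_step S R s t \<Longrightarrow> \<not> syms s \<subseteq> constructors S R"
proof (induction rule: rewrite_step.induct)
  case (rewrite_step_root l r \<phi> \<gamma>)
  from rule_root[OF assms rewrite_step_root(1)] show ?case by force
qed auto

lemma constructor_args_step: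
  assumes R: "lctrs S R"
    and step: "rewrite_step S R (Fun f ts) u"
    and args: "\<And>t. t \<in> set ts \<Longrightarrow> syms t \<subseteq> constructors S R"
  shows "rewrite_step S (constructor_rules S R) (Fun f ts) u"
    and "f \<in> calc_syms S \<union> defined_syms (constructor_rules S R)"
proof -
  obtain l r \<phi> \<gamma> where rule: "(l, r, \<phi>) \<in> R \<union> calc_rules S"
    and \<gamma>: "is_subst S \<gamma>" "respects_rule S \<gamma> (l, r, \<phi>)"
    and eq: "Fun f ts = subst \<gamma> l" "u = subst \<gamma> r"
    using step
  proof (cases rule: rewrite_step.cases)
    case rewrite_step_root
    then show ?thesis using that by blast
  next
    \<comment> \<open>The reducible argument \<open>s\<close> would contain a non-constructor,
      contrary to \<open>args\<close>.\<close>
    case (rewrite_step_arg s t us ws)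
    then show ?thesis using rewrite_step_not_constructor[OF R] args by force
  qed
  obtain ls where l: "l = Fun f ls" and ts: "ts = map (subst \<gamma>) ls"
    using rule_root[OF R rule] eq by force
  have mem: "(l, r, \<phi>) \<in> constructor_rules S R" if "(l, r, \<phi>) \<in> R"
  proof -
    have "is_term S l" using R that by (auto simp: lctrs_def wf_rule_def is_term_def)
    \<comment> \<open>Instantiation never removes symbols, so those of \<open>l'\<close> occur in an
      argument from \<open>ts\<close>; a sort for \<open>l'\<close> comes from the well-sortedness
      of \<open>l\<close>.\<close>
    then have "constructor_term S R l'" if l': "l' \<in> set ls" for l'
      using is_term_arg[of S f ls l'] l l' args ts syms_subset_syms_subst[of l' \<gamma>]
      by (fastforce simp: constructor_term_iff is_term_def)
    then show ?thesis using that l by (auto simp: constructor_rules_def)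
  qed
  then show "rewrite_step S (constructor_rules S R) (Fun f ts) u"
    unfolding eq using rule \<gamma> by (intro rewrite_step.rewrite_step_root) auto
  show "f \<in> calc_syms S \<union> defined_syms (constructor_rules S R)"
    using mem rule l by (auto simp: calc_rules_def defined_syms_def)
qed

lemma constructors_constructor_rules_subset:
  assumes R: "lctrs S R" and sound: "constructor_sound S R" and qr: "quasi_reductive S R"
  shows "constructors S (constructor_rules S R) \<subseteq> constructors S R"
proof
  fix f
  assume f: "f \<in> constructors S (constructor_rules S R)"
  show "f \<in> constructors S R"
  proof (rule ccontr)
    assume nf: "f \<notin> constructors S R"
    \<comment> \<open>So \<open>R\<close> has rules for \<open>f\<close>, but all of them are
      dropped in passing to \<open>constructor_rules S R\<close>.\<close>
    with f have f': "f \<in> term_syms S" "f \<in> defined_syms R"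
      "f \<notin> defined_syms (constructor_rules S R)" "f \<notin> vals S"
      by (auto simp: constructors_def)
    \<comment> \<open>A chosen ground constructor term for each argument sort of \<open>f\<close>,
      available because \<open>f\<close> is defined in \<open>R\<close>.\<close>
    define g where "g = (\<lambda>\<iota>. SOME t. vars t = {} \<and> has_sort S (constructors S R) t \<iota>)"
    have g: "vars (g \<iota>) = {} \<and> has_sort S (constructors S R) (g \<iota>) \<iota>"
      if "\<iota> \<in> set (arg_sorts S f)" for \<iota>
      unfolding g_def using sound f'(2) that
      by (intro someI_ex[of "\<lambda>t. vars t = {} \<and> has_sort S (constructors S R) t \<iota>"])
        (auto simp: constructor_sound_def)
    define ts where "ts = map g (arg_sorts S f)"
    have args: "syms t \<subseteq> constructors S R" if "t \<in> set ts" for t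
      using that g has_sort_imp_syms_subset unfolding ts_def by fastforce
    have sub: "constructors S R \<subseteq> all_syms S"
      using R by (auto simp: constructors_def all_syms_def lctrs_def wf_sig_def)
    have "list_all2 (has_sort S (all_syms S)) ts (arg_sorts S f)"
      unfolding ts_def list_all2_conv_all_nth
      using g has_sort_imp_syms_subset has_sort_change_syms sub
      by (metis (no_types, lifting) length_map nth_map nth_mem order_trans)
    then have "is_term S (Fun f ts)"
      using f'(1) by (auto simp: is_term_def all_syms_def intro: has_sort.has_sort_Fun)
    moreover have "vars (Fun f ts) = {}" using g by (auto simp: ts_def)
    moreover have "\<not> constructor_term S R (Fun f ts)"
      using nf by (simp add: constructor_term_iff)
    ultimately obtain u where "rewrite_step S R (Fun f ts) u"
      using qr unfolding quasi_reductive_def by blast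
    \<comment> \<open>As \<open>f\<close> has no rule left, it would have to be a calculation
      symbol; but a term symbol that is also a theory symbol is a value.\<close>
    from constructor_args_step(2)[OF R this args] f' R show False
      by (auto simp: calc_syms_def lctrs_def wf_sig_def)
  qed
qed

lemma quasi_reductive_constructor_rules:
  assumes R: "lctrs S R" and qr: "quasi_reductive S R"
    and sub: "constructors S (constructor_rules S R) \<subseteq> constructors S R"
  shows "quasi_reductive S (constructor_rules S R)"
proof -
  let ?R' = "constructor_rules S R"
  have "constructor_term S ?R' t \<or> (\<exists>u. rewrite_step S ?R' t u)"
    if "is_term S t" "vars t = {}" for t
    using that
  proof (induction t)
    case (Var x)
    then show ?case by simp
  next
    case (Fun f ts)
    show ?case
    proof (cases "\<exists>s\<in>set ts. \<exists>u. rewrite_step S ?R' s u")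
      case True
      then obtain us s ws u where "ts = us @ s # ws" "rewrite_step S ?R' s u"
        by (meson split_list)
      then show ?thesis using Fun.prems(1) by (auto intro: rewrite_step.rewrite_step_arg)
    next
      case False
      then have "constructor_term S ?R' s" if "s \<in> set ts" for s
        using Fun.IH[OF that] is_term_arg[OF Fun.prems(1) that] Fun.prems(2) that by auto
      \<comment> \<open>By induction the arguments are constructor terms for \<open>R'\<close>;
        condition (ii) makes them constructor terms for \<open>R\<close>, so that a step with
        \<open>R\<close> at \<open>Fun f ts\<close> becomes a step with \<open>R'\<close>.\<close>
      then have args: "syms s \<subseteq> constructors S R" if "s \<in> set ts" for s
        using that sub by (force simp: constructor_term_iff)
      show ?thesis
      proof (cases "constructor_term S R (Fun f ts)")
        case True
        \<comment> \<open>Fewer rules define fewer symbols, so every constructor for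
          \<open>R\<close> is one for \<open>R'\<close>.\<close>
        then show ?thesis
          using constructors_antimono[OF constructor_rules_subset, of S R]
          unfolding constructor_term_iff by blast
      next
        case False
        then obtain u where "rewrite_step S R (Fun f ts) u"
          using qr Fun.prems unfolding quasi_reductive_def by blast
        from constructor_args_step(1)[OF R this args] show ?thesis by blast
      qed
    qed
  qed
  then show ?thesis by (auto simp: quasi_reductive_def)
qed

theorem theoremB4:
  fixes S :: "('f, 's, 'v, 'd) lc_sig" and R R' :: "('f, 'v) rule set"
  assumes "lctrs S R"
    and "constructor_sound S R"
    and "R' = constructor_rules S R"
  shows "quasi_reductive S R \<longleftrightarrow>
    quasi_reductive S R' \<and> constructors S R' \<subseteq> constructors S R"
proof
  assume "quasi_reductive S R"
  with assms show "quasi_reductive S R' \<and> constructors S R' \<subseteq> constructors S R"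
    using constructors_constructor_rules_subset quasi_reductive_constructor_rules by blast
next
  assume qr: "quasi_reductive S R' \<and> constructors S R' \<subseteq> constructors S R"
  \<comment> \<open>Both alternatives of quasi-reductivity transfer from \<open>R'\<close> to
    \<open>R\<close>: constructor terms by (ii), steps because \<open>R'\<close> is a subset of
    \<open>R\<close>.\<close>
  have "constructor_term S R t" if "constructor_term S R' t" for t
    using that qr unfolding constructor_term_iff by blast
  moreover have "rewrite_step S R t u" if "rewrite_step S R' t u" for t u
    using rewrite_step_mono[OF that] constructor_rules_subset assms(3) by blast
  ultimately show "quasi_reductive S R"
    using qr unfolding quasi_reductive_def by blast
qed

end
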